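(* Let $n,m\ge1$ be integers, let the group $\{-1,1\}$ act on $\mathbb{C}^n$ by $\mathcal{A}(g,z):=gz$, let $f,g_1,\dots,g_m\in\mathbb{R}[\bar z,z]$ be real-valued complex polynomials on $\mathbb{C}^n$ with $K=\{z\in\mathbb{C}^n : g_i(z)\ge0,\ i=1,\dots,m\}$ compact, and assume that $f,g_1,\dots,g_m\in\mathbb{R}[\bar z,z]^{\{-1,1\}}$. Then, with the optimal values defined in the context (taken with $G=\{-1,1\}$), $\rho_d^{\{-1,1\}}=\rho_d$ and $(\rho_d^{\{-1,1\}})^*=\rho_d^*$ for all $d\ge d^{\min}$.
   Context: Notation. For $z\in\mathbb{C}^n$, $\alpha\in\mathbb{N}^n$: $z^\alpha=z_1^{\alpha_1}\cdots z_n^{\alpha_n}$, $|\alpha|=\alpha_1+\dots+\alpha_n$. $\mathbb{C}_d[z]$ is the set of holomorphic polynomials $\sum_{|\alpha|\le d}p_\alpha z^\alpha$ ($p_\alpha\in\mathbb{C}$); $\vec p:=(p_\alpha)_{|\alpha|\le d}$. $\mathbb{R}_d[\bar z,z]$ is the set of functions $\sum_{|\alpha|,|\beta|\le d}\varphi_{\alpha,\beta}\bar z^\alpha z^\beta$ ($\varphi_{\alpha,\beta}\in\mathbb{C}$) that are real-valued on $\mathbb{C}^n$; $\mathbb{R}[\bar z,z]=\bigcup_d\mathbb{R}_d[\bar z,z]$. $\Sigma_d[z]$ is the set of finite sums $\sum_{j=1}^r|p_j|^2$, $r\ge1$, with $p_j\in\mathbb{C}_d[z]$. Degrees. $f\in\mathbb{R}_k[\bar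 z,z]$, $g_i\in\mathbb{R}_{k_i}[\bar z,z]$, where there exist $|\alpha|=k$, $|\beta|\le k$ with $f_{\alpha,\beta}\ne0$, and $|\alpha|=k_i$, $|\beta|\le k_i$ with $g_{i,\alpha,\beta}\ne0$. $g_0:=1$, $k_0:=0$, $d^{\min}:=\max\{k,k_1,\dots,k_m\}$. Moments. $\mathcal{H}_d$ is the set of complex families $y=(y_{\alpha,\beta})_{|\alpha|,|\beta|\le d}$ with $\overline{y_{\alpha,\beta}}=y_{\beta,\alpha}$ (identified with Hermitian matrices). $L_y$ is linear with $L_y(\bar z^\alpha z^\beta)=y_{\alpha,\beta}$. $M_d(\varphi y)$ is the matrix indexed by $|\alpha|,|\beta|\le d$ with entries $\sum_{\gamma,\delta}\varphi_{\gamma,\delta}\,y_{\alpha+\gamma,\beta+\delta}$ for $\varphi=\sum\varphi_{\gamma,\delta}\bar z^\gamma z^\delta$. Invariance. For a group $G$ acting on $\mathbb{C}^n$ via $\mathcal{A}$ and $Y\subset\mathbb{R}[\bar z,z]$, $Y^G:=\{\varphi\in Y : \varphi(\mathcal{A}(g,z))=\varphi(z)\ \forall g\in G,\ z\in\mathbb{C}^n\}$. For $A\in\mathcal{H}_d$, $A\succcurlyeq^G0$ means $\vec p^{\,H}A\,\vec p\ge0$ for all $p\in\mathbb{C}_d[z]$ such that $|p|^2\in\Sigma_d[z]^G$. Optimal values, for $d\ge d^{\min}$: $$\rho_d:=\inf_{y\in\mathcal{H}_d}L_y(f)\ \text{ s.t. } y_{0,0}=1,\ M_{d-k_i}(g_iy)\succcurlyeq0,\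 i=0,\dots,m,$$ $$\rho_d^*:=\sup\Big\{\lambda\in\mathbb{R} : f-\lambda=\sum_{i=0}^m\sigma_ig_i,\ \sigma_i\in\Sigma_{d-k_i}[z]\Big\},$$ $$\rho_d^G:=\inf_{y\in\mathcal{H}_d}L_y(f)\ \text{ s.t. } y_{0,0}=1,\ M_{d-k_i}(g_iy)\succcurlyeq^G0,\ i=0,\dots,m,$$ $$(\rho_d^G)^*:=\sup\Big\{\lambda\in\mathbb{R} : f-\lambda=\sum_{i=0}^m\sigma_ig_i,\ \sigma_i\in\Sigma_{d-k_i}[z]^G\Big\}.$$ Infima over the empty set are $+\infty$, suprema over the empty set are $-\infty$. *)

theory Defs
  imports "HOL-Analysis.Analysis"
begin

section \<open>Holomorphic and real-valued complex polynomials on \<open>\<complex>\<^sup>n\<close>\<close>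

type_synonym 'n multi = "'n \<Rightarrow> nat"

definition mdeg :: "'n::finite multi \<Rightarrow> nat" where
  "mdeg \<alpha> = (\<Sum>i\<in>UNIV. \<alpha> i)"

definition madd :: "'n multi \<Rightarrow> 'n multi \<Rightarrow> 'n multi" where
  "madd \<alpha> \<beta> = (\<lambda>i. \<alpha> i + \<beta> i)"

definition multis :: "nat \<Rightarrow> 'n::finite multi set" where
  "multis d = {\<alpha>. mdeg \<alpha> \<le> d}"

definition mpow :: "complex ^ 'n::finite \<Rightarrow> 'n multi \<Rightarrow> complex" where
  "mpow z \<alpha> = (\<Prod>i\<in>UNIV. (z $ i) ^ \<alpha> i)"

definition vcnj :: "complex ^ 'n::finite \<Rightarrow> complex ^ 'n" where
  "vcnj z = (\<chi> i. cnj (z $ i))"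

text \<open>The value at \<open>z\<close> of the element of \<open>\<complex>\<^sub>d[z]\<close> whose vector of coefficients is
  \<open>p\<close>; the values of \<open>p\<close> at multi-indices of degree above \<open>d\<close> are ignored.\<close>

definition hol_eval :: "nat \<Rightarrow> ('n::finite multi \<Rightarrow> complex) \<Rightarrow> complex ^ 'n \<Rightarrow> complex" where
  "hol_eval d p z = (\<Sum>\<alpha>\<in>multis d. p \<alpha> * mpow z \<alpha>)"

definition hol_polys :: "nat \<Rightarrow> (complex ^ 'n::finite \<Rightarrow> complex) set" where
  "hol_polys d = range (hol_eval d)"

definition real_polys_deg :: "nat \<Rightarrow> (complex ^ 'n::finite \<Rightarrow> real) set" where
  "real_polys_deg d = {\<phi>. \<exists>c. \<forall>z. complex_of_real (\<phi> z) =
     (\<Sum>\<alpha>\<in>multis d. \<Sum>\<beta>\<in>multis d. c \<alpha> \<beta> * mpow (vcnj z) \<alpha> * mpow z \<beta>)}"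

definition real_polys :: "(complex ^ 'n::finite \<Rightarrow> real) set" where
  "real_polys = (\<Union>d. real_polys_deg d)"

text \<open>The coefficients \<open>\<phi>\<^bsub>\<alpha>,\<beta>\<^esub>\<close> of \<open>\<phi>\<close>. A finitely supported
  family of coefficients is uniquely determined by the function it represents, so the
  description below denotes for every \<open>\<phi> \<in> real_polys\<close>.\<close>

definition coeffs :: "(complex ^ 'n::finite \<Rightarrow> real) \<Rightarrow> 'n multi \<Rightarrow> 'n multi \<Rightarrow> complex" where
  "coeffs \<phi> = (THE c. finite {(\<alpha>, \<beta>). c \<alpha> \<beta> \<noteq> 0} \<and>
     (\<forall>z. complex_of_real (\<phi> z) =
       (\<Sum>(\<alpha>, \<beta>) | c \<alpha> \<beta> \<noteq> 0. c \<alpha> \<beta> * mpow (vcnj z) \<alpha> * mpow z \<beta>)))"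

definition has_degree :: "(complex ^ 'n::finite \<Rightarrow> real) \<Rightarrow> nat \<Rightarrow> bool" where
  "has_degree \<phi> k \<longleftrightarrow> \<phi> \<in> real_polys_deg k \<and>
     (\<exists>\<alpha> \<beta>. mdeg \<alpha> = k \<and> mdeg \<beta> \<le> k \<and> coeffs \<phi> \<alpha> \<beta> \<noteq> 0)"

definition sos :: "nat \<Rightarrow> (complex ^ 'n::finite \<Rightarrow> real) set" where
  "sos d = {\<phi>. \<exists>(r::nat) p. r \<ge> 1 \<and> (\<forall>j\<in>{1..r}. p j \<in> hol_polys d) \<and>
     (\<forall>z. \<phi> z = (\<Sum>j=1..r. (cmod (p j z))\<^sup>2))}"

section \<open>Invariance\<close>

definition invariants ::
  "'g set \<Rightarrow> ('g \<Rightarrow> complex ^ 'n::finite \<Rightarrow> complex ^ 'n) \<Rightarrow>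
   (complex ^ 'n \<Rightarrow> real) set \<Rightarrow> (complex ^ 'n \<Rightarrow> real) set" where
  "invariants G act Y = {\<phi>\<in>Y. \<forall>g\<in>G. \<forall>z. \<phi> (act g z) = \<phi> z}"

section \<open>Truncated moment families\<close>

text \<open>A family indexed by \<open>|\<alpha>|, |\<beta>| \<le> d\<close> is extended by zero to all pairs of
  multi-indices.\<close>

definition herm :: "nat \<Rightarrow> ('n::finite multi \<Rightarrow> 'n multi \<Rightarrow> complex) set" where
  "herm d = {y. (\<forall>\<alpha> \<beta>. \<alpha> \<notin> multis d \<or> \<beta> \<notin> multis d \<longrightarrow> y \<alpha> \<beta> = 0) \<and>
     (\<forall>\<alpha>\<in>multis d. \<forall>\<beta>\<in>multis d. cnj (y \<alpha> \<beta>) = y \<beta> \<alpha>)}"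

definition riesz ::
  "('n::finite multi \<Rightarrow> 'n multi \<Rightarrow> complex) \<Rightarrow> (complex ^ 'n \<Rightarrow> real) \<Rightarrow> complex" where
  "riesz y \<phi> = (\<Sum>(\<alpha>, \<beta>) | coeffs \<phi> \<alpha> \<beta> \<noteq> 0. coeffs \<phi> \<alpha> \<beta> * y \<alpha> \<beta>)"

text \<open>Entries of \<open>M\<^sub>d(\<phi> y)\<close>; the size \<open>d\<close> is imposed where the matrix is used.\<close>

definition loc_mat ::
  "(complex ^ 'n::finite \<Rightarrow> real) \<Rightarrow> ('n multi \<Rightarrow> 'n multi \<Rightarrow> complex) \<Rightarrow>
   'n multi \<Rightarrow> 'n multi \<Rightarrow> complex" where
  "loc_mat \<phi> y \<alpha> \<beta> =
     (\<Sum>(\<gamma>, \<delta>) | coeffs \<phi> \<gamma> \<delta> \<noteq> 0. coeffs \<phi> \<gamma> \<delta> * y (madd \<alpha> \<gamma>) (madd \<beta> \<delta>))"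

text \<open>The number \<open>p\<^sup>H A p\<close>.\<close>

definition quad_form ::
  "nat \<Rightarrow> ('n::finite multi \<Rightarrow> 'n multi \<Rightarrow> complex) \<Rightarrow> ('n multi \<Rightarrow> complex) \<Rightarrow> complex" where
  "quad_form d A p = (\<Sum>\<alpha>\<in>multis d. \<Sum>\<beta>\<in>multis d. cnj (p \<alpha>) * A \<alpha> \<beta> * p \<beta>)"

definition psd :: "nat \<Rightarrow> ('n::finite multi \<Rightarrow> 'n multi \<Rightarrow> complex) \<Rightarrow> bool" where
  "psd d A \<longleftrightarrow> (\<forall>p. quad_form d A p \<in> \<real>\<^sub>\<ge>\<^sub>0)"

definition psd_inv ::
  "'g set \<Rightarrow> ('g \<Rightarrow> complex ^ 'n::finite \<Rightarrow> complex ^ 'n) \<Rightarrow>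
   nat \<Rightarrow> ('n multi \<Rightarrow> 'n multi \<Rightarrow> complex) \<Rightarrow> bool" where
  "psd_inv G act d A \<longleftrightarrow>
     (\<forall>p. (\<lambda>z. (cmod (hol_eval d p z))\<^sup>2) \<in> invariants G act (sos d) \<longrightarrow>
          quad_form d A p \<in> \<real>\<^sub>\<ge>\<^sub>0)"

section \<open>Optimal values of the relaxations\<close>

text \<open>
  The constraints \<open>g\<close> and their degrees \<open>k\<close> are given at the indices \<open>1, \<dots>, m\<close>; the
  updates at \<open>0\<close> install the conventions \<open>g\<^sub>0 = 1\<close> and \<open>k\<^sub>0 = 0\<close>. For a real-valued
  \<open>f\<close> of degree at most \<open>d\<close> and \<open>y \<in> herm d\<close> the number \<open>riesz y f\<close> is real. In
  \<^typ>\<open>ereal\<close> the infimum and supremum of the empty set are \<open>\<infinity>\<close> and \<open>-\<infinity>\<close>.\<close>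

definition g_ext :: "(nat \<Rightarrow> complex ^ 'n::finite \<Rightarrow> real) \<Rightarrow> nat \<Rightarrow> complex ^ 'n \<Rightarrow> real" where
  "g_ext g = g(0 := (\<lambda>_. 1))"

definition k_ext :: "(nat \<Rightarrow> nat) \<Rightarrow> nat \<Rightarrow> nat" where
  "k_ext k = k(0 := 0)"

definition rho ::
  "(complex ^ 'n::finite \<Rightarrow> real) \<Rightarrow> nat \<Rightarrow> (nat \<Rightarrow> complex ^ 'n \<Rightarrow> real) \<Rightarrow> (nat \<Rightarrow> nat) \<Rightarrow>
   nat \<Rightarrow> ereal" where
  "rho f m g k d =
     Inf {ereal (Re (riesz y f)) | y. y \<in> herm d \<and> y (\<lambda>_. 0) (\<lambda>_. 0) = 1 \<and>
       (\<forall>i\<in>{0..m}. psd (d - k_ext k i) (loc_mat (g_ext g i) y))}"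

definition rho_dual ::
  "(complex ^ 'n::finite \<Rightarrow> real) \<Rightarrow> nat \<Rightarrow> (nat \<Rightarrow> complex ^ 'n \<Rightarrow> real) \<Rightarrow> (nat \<Rightarrow> nat) \<Rightarrow>
   nat \<Rightarrow> ereal" where
  "rho_dual f m g k d =
     Sup {ereal l | l. \<exists>\<sigma>. (\<forall>i\<in>{0..m}. \<sigma> i \<in> sos (d - k_ext k i)) \<and>
       (\<forall>z. f z - l = (\<Sum>i=0..m. \<sigma> i z * g_ext g i z))}"

definition rho_inv ::
  "'g set \<Rightarrow> ('g \<Rightarrow> complex ^ 'n::finite \<Rightarrow> complex ^ 'n) \<Rightarrow>
   (complex ^ 'n \<Rightarrow> real) \<Rightarrow> nat \<Rightarrow> (nat \<Rightarrow> complex ^ 'n \<Rightarrow> real) \<Rightarrow> (nat \<Rightarrow> nat) \<Rightarrow>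
   nat \<Rightarrow> ereal" where
  "rho_inv G act f m g k d =
     Inf {ereal (Re (riesz y f)) | y. y \<in> herm d \<and> y (\<lambda>_. 0) (\<lambda>_. 0) = 1 \<and>
       (\<forall>i\<in>{0..m}. psd_inv G act (d - k_ext k i) (loc_mat (g_ext g i) y))}"

definition rho_inv_dual ::
  "'g set \<Rightarrow> ('g \<Rightarrow> complex ^ 'n::finite \<Rightarrow> complex ^ 'n) \<Rightarrow>
   (complex ^ 'n \<Rightarrow> real) \<Rightarrow> nat \<Rightarrow> (nat \<Rightarrow> complex ^ 'n \<Rightarrow> real) \<Rightarrow> (nat \<Rightarrow> nat) \<Rightarrow>
   nat \<Rightarrow> ereal" where
  "rho_inv_dual G act f m g k d =
     Sup {ereal l | l. \<exists>\<sigma>. (\<forall>i\<in>{0..m}. \<sigma> i \<in> invariants G act (sos (d - k_ext k i))) \<and>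
       (\<forall>z. f z - l = (\<Sum>i=0..m. \<sigma> i z * g_ext g i z))}"

definition d_min :: "nat \<Rightarrow> nat \<Rightarrow> (nat \<Rightarrow> nat) \<Rightarrow> nat" where
  "d_min kf m k = Max (insert kf (k ` {1..m}))"

section \<open>The group \<open>{-1, 1}\<close> acting on \<open>\<complex>\<^sup>n\<close>\<close>

definition signs :: "complex set" where
  "signs = {-1, 1}"

definition sign_act :: "complex \<Rightarrow> complex ^ 'n::finite \<Rightarrow> complex ^ 'n" where
  "sign_act g z = g *s z"

end

theory Submission
  imports Defs
begin

text \<open>
  Coefficients of an even real polynomial are supported on pairs with \<open>|\<alpha>| + |\<beta>|\<close> even.
  On the moment side, one may therefore set the entries of \<open>y\<close> with \<open>|\<alpha>| + |\<beta>|\<close> odd to zero: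
  this leaves \<open>L\<^sub>y(f)\<close> unchanged and splits the quadratic form at \<open>p\<close> into the sum of the original
  quadratic forms at the even and the odd part of \<open>p\<close>, both of which have an invariant squared
  modulus. On the dual side, one averages the multipliers \<open>\<sigma>\<^sub>i\<close> over the group.
\<close>

text \<open>Dedekind's argument on the independence of characters.\<close>

lemma multiplicative_functions_independent:
  fixes \<psi> :: "'i \<Rightarrow> 'a \<Rightarrow> 'b::field"
  assumes "finite I" "inj_on \<psi> I"
    and mult: "\<And>i x y. i \<in> I \<Longrightarrow> \<psi> i (m x y) = \<psi> i x * \<psi> i y"
    and nonzero: "\<And>i. i \<in> I \<Longrightarrow> \<psi> i e \<noteq> 0"
    and zero: "\<And>x. (\<Sum>i\<in>I. c i * \<psi> i x) = 0"
    and "i \<in> I"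
  shows "c i = 0"
  using assms
proof (induction I arbitrary: c i rule: finite_induct)
  case empty
  then show ?case by simp
next
  case (insert j I)
  have sum_eq: "(\<Sum>i\<in>I. c i * \<psi> i x) = - (c j * \<psi> j x)" for x
    using insert.prems(4)[of x] insert.hyps by (simp add: eq_neg_iff_add_eq_0 add.commute)
  have others: "c i = 0" if "i \<in> I" for i
  proof -
    \<comment> \<open>For fixed \<open>y\<close>, subtracting \<open>\<psi> j y\<close> times the
      relation at \<open>x\<close> from the relation at \<open>m x y\<close> cancels the term of
      \<open>j\<close>. What is left is a relation over \<open>I\<close> with these coefficients, to
      which the induction hypothesis applies.\<close>
    have "c i * (\<psi> i y - \<psi> j y) = 0" for y
    proof (rule insert.IH[OF _ _ _ _ that, where c = "\<lambda>i. c i * (\<psi> i y - \<psi> j y)"])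
      show "inj_on \<psi> I" using insert.prems(1) by simp
      show "\<psi> i (m x y) = \<psi> i x * \<psi> i y" if "i \<in> I" for i x y
        using insert.prems(2) that by simp
      show "\<psi> i e \<noteq> 0" if "i \<in> I" for i
        using insert.prems(3) that by simp
      show "(\<Sum>i\<in>I. c i * (\<psi> i y - \<psi> j y) * \<psi> i x) = 0" for x
      proof -
        have "(\<Sum>i\<in>I. c i * (\<psi> i y - \<psi> j y) * \<psi> i x)
            = (\<Sum>i\<in>I. c i * \<psi> i (m x y)) - \<psi> j y * (\<Sum>i\<in>I. c i * \<psi> i x)"
          unfolding sum_distrib_left sum_subtractf[symmetric]
          by (rule sum.cong) (auto simp: insert.prems(2) algebra_simps)
        also have "\<dots> = - (c j * \<psi> j (m x y)) - \<psi> j y * - (c j * \<psi> j x)"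
          by (simp only: sum_eq)
        also have "\<dots> = 0"
          using insert.prems(2)[of j x y] by simp
        finally show ?thesis .
      qed
    qed
    moreover have "\<psi> i \<noteq> \<psi> j"
      using insert.prems(1) insert.hyps(2) that by (auto simp: inj_on_def)
    ultimately show ?thesis by (auto simp: fun_eq_iff)
  qed
  moreover have "c j = 0"
    using insert.prems(3)[of j] sum_eq[of e] others by simp
  ultimately show ?case using insert.prems(5) by auto
qed

section \<open>Independence of the monomials and uniqueness of coefficients\<close>

lemma finite_multis: "finite (multis d :: 'n::finite multi set)"
proof (rule finite_subset)
  show "(multis d :: 'n multi set) \<subseteq> Pi\<^sub>E UNIV (\<lambda>_. {..d})"
  proof
    fix \<alpha> :: "'n multi"
    assume "\<alpha> \<in> multis d"
    moreover have "\<alpha> i \<le> mdeg \<alpha>" for i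
      unfolding mdeg_def by (rule member_le_sum) auto
    ultimately show "\<alpha> \<in> Pi\<^sub>E UNIV (\<lambda>_. {..d})"
      by (auto simp: multis_def PiE_UNIV_domain intro: order_trans)
  qed
  show "finite (Pi\<^sub>E (UNIV :: 'n set) (\<lambda>_. {..d}))"
    by (rule finite_PiE) auto
qed

text \<open>Indexing by pairs turns the monomials in conjugated and plain variables into one family
  of functions that are multiplicative for the coordinatewise product, as Dedekind's argument
  requires.\<close>

definition bimonom :: "'n multi \<times> 'n multi \<Rightarrow> complex ^ 'n::finite \<Rightarrow> complex" where
  "bimonom i z = mpow (vcnj z) (fst i) * mpow z (snd i)"

lemma bimonom_mult: "bimonom i (\<chi> j. x $ j * y $ j) = bimonom i x * bimonom i y"
  by (simp add: bimonom_def mpow_def vcnj_def power_mult_distrib prod.distrib)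

lemma bimonom_one: "bimonom i (\<chi> j. 1) = 1"
  by (simp add: bimonom_def mpow_def vcnj_def)

lemma bimonom_axis:
  "bimonom (\<alpha>, \<beta>) (\<chi> i. if i = j then w else 1) = cnj w ^ \<alpha> j * w ^ \<beta> j"
proof -
  have "(\<Prod>i\<in>UNIV. (if i = j then v else 1) ^ \<gamma> i) = v ^ \<gamma> j"
    for v :: complex and \<gamma> :: "'a multi"
  proof -
    have "(\<Prod>i\<in>UNIV. (if i = j then v else 1) ^ \<gamma> i) = (\<Prod>i\<in>UNIV. if i = j then v ^ \<gamma> i else 1)"
      by (rule prod.cong) auto
    then show ?thesis by simp
  qed
  moreover have "vcnj (\<chi> i. if i = j then w else 1) = (\<chi> i. if i = j then cnj w else 1)"
    by (simp add: vcnj_def vec_eq_iff)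
  ultimately show ?thesis by (simp add: bimonom_def mpow_def)
qed

text \<open>The value at 2 determines the sum of the exponents, and the values on the unit circle
  determine their difference.\<close>

lemma cnj_power_mult_power_inj:
  assumes eq: "\<And>w::complex. cnj w ^ a * w ^ b = cnj w ^ a' * w ^ b'"
  shows "a = a' \<and> b = b'"
proof -
  have "(2::complex) ^ (a + b) = 2 ^ (a' + b')"
    using eq[of 2] by (simp add: power_add)
  then have "norm ((2::complex) ^ (a + b)) = norm ((2::complex) ^ (a' + b'))"
    by (rule arg_cong)
  then have sum: "a + b = a' + b'" by (simp add: norm_power)
  have cis_eq: "cis (x * (real b - real a)) = cis (x * (real b' - real a'))" for x
  proof -
    have "cnj (cis x) ^ r * cis x ^ s = cis (x * (real s - real r))" for r s
    proof -
      have "cnj (cis x) ^ r * cis x ^ s = cis (real r * (- x) + real s * x)"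
        by (simp only: cis_cnj Complex.DeMoivre cis_mult)
      then show ?thesis by (simp add: algebra_simps)
    qed
    with eq[of "cis x"] show ?thesis by metis
  qed
  \<comment> \<open>The discrepancy between the two exponent differences. At the angle
    \<open>pi / t\<close> a nonzero \<open>t\<close> would give \<open>cis pi = 1\<close>.\<close>
  define t where "t = (real b - real a) - (real b' - real a')"
  have "cis (x * t) = 1" for x
  proof -
    have "x * t = x * (real b - real a) - x * (real b' - real a')"
      by (simp add: t_def right_diff_distrib)
    then show ?thesis using cis_eq[of x] by (simp flip: cis_divide)
  qed
  from this[of "pi / t"] have "t = 0" by (cases "t = 0") auto
  with sum show ?thesis by (simp add: t_def)
qed

text \<open>Letting one coordinate vary and fixing the others at 1 isolates the two exponents of
  that coordinate.\<close>

lemma inj_bimonom: "inj (bimonom :: 'n multi \<times> 'n multi \<Rightarrow> complex ^ 'n::finite \<Rightarrow> complex)"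
proof (rule injI)
  fix p q :: "'n multi \<times> 'n multi"
  assume eq: "bimonom p = bimonom q"
  obtain \<alpha> \<beta> \<alpha>' \<beta>' where pq: "p = (\<alpha>, \<beta>)" "q = (\<alpha>', \<beta>')"
    by (cases p, cases q)
  have "\<alpha> j = \<alpha>' j \<and> \<beta> j = \<beta>' j" for j
  proof (rule cnj_power_mult_power_inj)
    show "cnj w ^ \<alpha> j * w ^ \<beta> j = cnj w ^ \<alpha>' j * w ^ \<beta>' j" for w
      using fun_cong[OF eq, of "\<chi> i. if i = j then w else 1"] by (simp add: pq bimonom_axis)
  qed
  then show "p = q" by (auto simp: pq)
qed

text \<open>The predicate inside the definite description of \<open>coeffs\<close>, named so that
  existence and uniqueness can be proved separately.\<close>

definition represents ::
  "('n::finite multi \<Rightarrow> 'n multi \<Rightarrow> complex) \<Rightarrow> (complex ^ 'n \<Rightarrow> real) \<Rightarrow> bool" where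
  "represents c \<phi> \<longleftrightarrow> finite {(\<alpha>, \<beta>). c \<alpha> \<beta> \<noteq> 0} \<and>
     (\<forall>z. complex_of_real (\<phi> z) =
       (\<Sum>(\<alpha>, \<beta>) | c \<alpha> \<beta> \<noteq> 0. c \<alpha> \<beta> * mpow (vcnj z) \<alpha> * mpow z \<beta>))"

lemma coeffs_eq_The_represents: "coeffs \<phi> = (THE c. represents c \<phi>)"
  by (simp add: coeffs_def represents_def)

text \<open>Families with different supports can thereby be compared over a common finite index
  set.\<close>

lemma represents_sum:
  assumes "represents c \<phi>" "finite S" "{(\<alpha>, \<beta>). c \<alpha> \<beta> \<noteq> 0} \<subseteq> S"
  shows "complex_of_real (\<phi> z) = (\<Sum>i\<in>S. case_prod c i * bimonom i z)"
proof -
  have "complex_of_real (\<phi> z) = (\<Sum>i\<in>{(\<alpha>, \<beta>). c \<alpha> \<beta> \<noteq> 0}. case_prod c i * bimonom i z)"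
    using assms(1) by (simp add: represents_def bimonom_def case_prod_unfold mult.assoc)
  also have "\<dots> = (\<Sum>i\<in>S. case_prod c i * bimonom i z)"
    by (rule sum.mono_neutral_left) (use assms in auto)
  finally show ?thesis .
qed

text \<open>Over the union of the supports, the difference of the two families is a vanishing linear
  combination of distinct multiplicative functions.\<close>

lemma represents_unique:
  assumes "represents c \<phi>" "represents c' \<phi>"
  shows "c = c'"
proof -
  let ?S = "{(\<alpha>, \<beta>). c \<alpha> \<beta> \<noteq> 0} \<union> {(\<alpha>, \<beta>). c' \<alpha> \<beta> \<noteq> 0}"
  have fin: "finite ?S" using assms by (simp add: represents_def)
  have "case_prod c i - case_prod c' i = 0" if "i \<in> ?S" for i
  proof (rule multiplicative_functions_independent[OF fin _ _ _ _ that, where \<psi> = bimonom and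
        m = "\<lambda>x y. \<chi> j. x $ j * y $ j" and e = "\<chi> j. 1" and c = "\<lambda>i. case_prod c i - case_prod c' i"])
    show "inj_on bimonom ?S" using inj_bimonom by (rule inj_on_subset) simp
    show "(\<Sum>i\<in>?S. (case_prod c i - case_prod c' i) * bimonom i z) = 0" for z
      using represents_sum[OF assms(1) fin, of z] represents_sum[OF assms(2) fin, of z]
      unfolding left_diff_distrib sum_subtractf by simp
  qed (simp_all add: bimonom_mult bimonom_one)
  then have "c \<alpha> \<beta> = c' \<alpha> \<beta>" for \<alpha> \<beta>
    by (cases "(\<alpha>, \<beta>) \<in> ?S") auto
  then show ?thesis by blast
qed

text \<open>Makes the definite description usable: a representing family exists by membership in
  \<open>real_polys\<close> and is unique by independence.\<close>

lemma represents_coeffs: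
  assumes "\<phi> \<in> real_polys"
  shows "represents (coeffs \<phi>) \<phi>"
proof -
  obtain d c where c: "\<And>z. complex_of_real (\<phi> z) =
     (\<Sum>\<alpha>\<in>multis d. \<Sum>\<beta>\<in>multis d. c \<alpha> \<beta> * mpow (vcnj z) \<alpha> * mpow z \<beta>)"
    using assms by (auto simp: real_polys_def real_polys_deg_def)
  \<comment> \<open>\<open>c\<close> is arbitrary outside degree \<open>d\<close>; cutting it off
    there gives the finite support that \<open>represents\<close> demands.\<close>
  define b where "b \<alpha> \<beta> = (if \<alpha> \<in> multis d \<and> \<beta> \<in> multis d then c \<alpha> \<beta> else 0)" for \<alpha> \<beta>
  have fin: "finite (multis d \<times> multis d :: ('a multi \<times> 'a multi) set)"
    by (simp add: finite_multis)
  have sub: "{(\<alpha>, \<beta>). b \<alpha> \<beta> \<noteq> 0} \<subseteq> multis d \<times> multis d"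
    by (auto simp: b_def)
  have "complex_of_real (\<phi> z) = (\<Sum>(\<alpha>, \<beta>) | b \<alpha> \<beta> \<noteq> 0. b \<alpha> \<beta> * mpow (vcnj z) \<alpha> * mpow z \<beta>)" for z
  proof -
    have "complex_of_real (\<phi> z)
        = (\<Sum>(\<alpha>, \<beta>)\<in>multis d \<times> multis d. b \<alpha> \<beta> * mpow (vcnj z) \<alpha> * mpow z \<beta>)"
      unfolding c sum.cartesian_product by (rule sum.cong) (auto simp: b_def)
    also have "\<dots> = (\<Sum>(\<alpha>, \<beta>) | b \<alpha> \<beta> \<noteq> 0. b \<alpha> \<beta> * mpow (vcnj z) \<alpha> * mpow z \<beta>)"
      by (rule sum.mono_neutral_right[OF fin sub]) auto
    finally show ?thesis .
  qed
  with finite_subset[OF sub fin] have "represents b \<phi>" by (simp add: represents_def)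
  then show ?thesis
    unfolding coeffs_eq_The_represents 
    by (rule theI[where P = "\<lambda>c. represents c \<phi>"]) (rule represents_unique[OF _ \<open>represents b \<phi>\<close>])
qed

section \<open>The reflection \<open>z \<mapsto> -z\<close> and the parity of coefficients\<close>

lemma mpow_uminus: "mpow (- z) \<alpha> = (-1) ^ mdeg \<alpha> * mpow z \<alpha>"
proof -
  have "mpow (- z) \<alpha> = (\<Prod>i\<in>UNIV. (-1) ^ \<alpha> i * (z $ i) ^ \<alpha> i)"
    unfolding mpow_def by (rule prod.cong) (auto simp flip: power_mult_distrib)
  then show ?thesis by (simp add: mpow_def mdeg_def prod.distrib power_sum)
qed

lemma vcnj_uminus: "vcnj (- z) = - vcnj z"
  by (simp add: vcnj_def vec_eq_iff)

lemma mem_invariants_signs: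
  "\<phi> \<in> invariants signs sign_act Y \<longleftrightarrow> \<phi> \<in> Y \<and> (\<forall>z. \<phi> (- z) = \<phi> z)"
proof -
  have "(-1) *s z = - z" "1 *s z = z" for z :: "complex ^ 'a"
    by (simp_all add: vec_eq_iff)
  then show ?thesis by (auto simp: invariants_def signs_def sign_act_def)
qed

text \<open>Replacing \<open>z\<close> by \<open>-z\<close> multiplies each coefficient by a parity
  sign. By invariance the signed family represents the same function, so uniqueness forces each odd
  coefficient to equal its own negative.\<close>

lemma coeffs_odd_eq_0:
  assumes "\<phi> \<in> invariants signs sign_act real_polys" and "odd (mdeg \<alpha> + mdeg \<beta>)"
  shows "coeffs \<phi> \<alpha> \<beta> = 0"
proof -
  define c where "c \<alpha> \<beta> = (-1) ^ (mdeg \<alpha> + mdeg \<beta>) * coeffs \<phi> \<alpha> \<beta>" for \<alpha> \<beta>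
  have rep: "represents (coeffs \<phi>) \<phi>" and even: "\<And>z. \<phi> (- z) = \<phi> z"
    using assms(1) represents_coeffs by (auto simp: mem_invariants_signs)
  \<comment> \<open>The sums in \<open>represents\<close> range over the support, so equal supports
    allow a termwise comparison.\<close>
  have supp: "c \<alpha> \<beta> \<noteq> 0 \<longleftrightarrow> coeffs \<phi> \<alpha> \<beta> \<noteq> 0" for \<alpha> \<beta>
    by (simp add: c_def)
  have "complex_of_real (\<phi> z) = (\<Sum>(\<alpha>, \<beta>) | c \<alpha> \<beta> \<noteq> 0. c \<alpha> \<beta> * mpow (vcnj z) \<alpha> * mpow z \<beta>)" for z
  proof -
    have "complex_of_real (\<phi> z) = complex_of_real (\<phi> (- z))" by (simp add: even)
    also have "\<dots> = (\<Sum>(\<alpha>, \<beta>) | coeffs \<phi> \<alpha> \<beta> \<noteq> 0.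
        coeffs \<phi> \<alpha> \<beta> * mpow (vcnj (- z)) \<alpha> * mpow (- z) \<beta>)"
      using rep by (simp only: represents_def)
    also have "\<dots> = (\<Sum>(\<alpha>, \<beta>) | c \<alpha> \<beta> \<noteq> 0. c \<alpha> \<beta> * mpow (vcnj z) \<alpha> * mpow z \<beta>)"
      unfolding supp
      by (rule sum.cong) (auto simp: c_def mpow_uminus vcnj_uminus power_add)
    finally show ?thesis .
  qed
  then have "represents c \<phi>"
    using rep by (simp add: represents_def supp)
  from represents_unique[OF this rep] have "c \<alpha> \<beta> = coeffs \<phi> \<alpha> \<beta>" by simp
  with assms(2) show ?thesis by (simp add: c_def)
qed

text \<open>Covers the constraint at index 0, where \<open>g_ext\<close> installs the constant
  1.\<close>

lemma one_mem_invariants: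
  "(\<lambda>_. 1) \<in> invariants signs sign_act (real_polys :: (complex ^ 'n::finite \<Rightarrow> real) set)"
proof -
  have "(multis 0 :: 'n multi set) = {\<lambda>_. 0}"
    by (auto simp: multis_def mdeg_def fun_eq_iff)
  then have "(\<lambda>_. 1) \<in> (real_polys_deg 0 :: (complex ^ 'n \<Rightarrow> real) set)"
    by (auto simp: real_polys_deg_def mpow_def intro!: exI[of _ "\<lambda>_ _. 1"])
  then show ?thesis by (auto simp: mem_invariants_signs real_polys_def)
qed

section \<open>The moment side: discarding odd moments\<close>

lemma mdeg_madd: "mdeg (madd \<alpha> \<beta>) = mdeg \<alpha> + mdeg \<beta>"
  by (simp add: mdeg_def madd_def sum.distrib)

text \<open>The group average of \<open>y\<close>: the reflection sends
  \<open>y \<alpha> \<beta>\<close> to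
  \<open>(-1) ^ (mdeg \<alpha> + mdeg \<beta>) * y \<alpha> \<beta>\<close>, and the mean with
  \<open>y\<close> keeps exactly the even entries.\<close>

definition even_moments ::
  "('n::finite multi \<Rightarrow> 'n multi \<Rightarrow> complex) \<Rightarrow> 'n multi \<Rightarrow> 'n multi \<Rightarrow> complex" where
  "even_moments y \<alpha> \<beta> = (if even (mdeg \<alpha> + mdeg \<beta>) then y \<alpha> \<beta> else 0)"

lemma even_moments_herm: "y \<in> herm d \<Longrightarrow> even_moments y \<in> herm d"
  by (auto simp: herm_def even_moments_def)

lemma riesz_even_moments:
  assumes "\<phi> \<in> invariants signs sign_act real_polys"
  shows "riesz (even_moments y) \<phi> = riesz y \<phi>"
proof -
  have "even (mdeg \<alpha> + mdeg \<beta>)" if "coeffs \<phi> \<alpha> \<beta> \<noteq> 0" for \<alpha> \<beta>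
    using coeffs_odd_eq_0[OF assms] that by blast
  then show ?thesis
    unfolding riesz_def by (intro sum.cong) (auto simp: even_moments_def simp del: even_add)
qed

lemma loc_mat_even_moments:
  assumes "\<phi> \<in> invariants signs sign_act real_polys"
  shows "loc_mat \<phi> (even_moments y) = even_moments (loc_mat \<phi> y)"
proof (intro ext)
  fix \<alpha> \<beta>
  \<comment> \<open>Only pairs \<open>\<gamma>\<close>, \<open>\<delta>\<close> of even total degree
    contribute, so every moment in an entry of the localizing matrix has the parity of that entry:
    either all terms survive or all vanish.\<close>
  have "even (mdeg (madd \<alpha> \<gamma>) + mdeg (madd \<beta> \<delta>)) \<longleftrightarrow> even (mdeg \<alpha> + mdeg \<beta>)"
    if "coeffs \<phi> \<gamma> \<delta> \<noteq> 0" for \<gamma> \<delta>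
    using coeffs_odd_eq_0[OF assms, of \<gamma> \<delta>] that by (auto simp: mdeg_madd)
  then show "loc_mat \<phi> (even_moments y) \<alpha> \<beta> = even_moments (loc_mat \<phi> y) \<alpha> \<beta>"
    unfolding loc_mat_def even_moments_def
    by (cases "even (mdeg \<alpha> + mdeg \<beta>)") (auto intro!: sum.cong sum.neutral)
qed

definition parity_part :: "bool \<Rightarrow> ('n::finite multi \<Rightarrow> complex) \<Rightarrow> 'n multi \<Rightarrow> complex" where
  "parity_part b p \<alpha> = (if even (mdeg \<alpha>) = b then p \<alpha> else 0)"

text \<open>Without entries of mixed parity the matrix is block diagonal, so no cross terms between
  the even and odd parts of \<open>p\<close> remain.\<close>

lemma quad_form_even_moments:
  "quad_form d (even_moments A) p =
     quad_form d A (parity_part True p) + quad_form d A (parity_part False p)"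
  unfolding quad_form_def sum.distrib[symmetric]
  by (intro sum.cong) (auto simp: even_moments_def parity_part_def)

lemma cmod_sq_hol_eval_mem_sos: "(\<lambda>z. (cmod (hol_eval d p z))\<^sup>2) \<in> sos d"
  unfolding sos_def hol_polys_def
  by (auto intro!: exI[of _ "1::nat"] exI[of _ "\<lambda>_. hol_eval d p"])

lemma hol_eval_uminus: "hol_eval d p (- z) = hol_eval d (\<lambda>\<alpha>. (-1) ^ mdeg \<alpha> * p \<alpha>) z"
  by (simp add: hol_eval_def mpow_uminus mult_ac)

text \<open>An odd polynomial changes sign under the reflection, but its squared modulus does not.
  Hence \<open>psd_inv\<close> tests odd polynomials as well as even ones.\<close>

lemma cmod_sq_parity_part_mem_invariants:
  "(\<lambda>z. (cmod (hol_eval d (parity_part b p) z))\<^sup>2) \<in> invariants signs sign_act (sos d)"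
proof -
  have "hol_eval d (parity_part b p) (- z) = (if b then 1 else -1) * hol_eval d (parity_part b p) z"
    for z
    unfolding hol_eval_uminus unfolding hol_eval_def sum_distrib_left
    by (rule sum.cong) (auto simp: parity_part_def)
  then show ?thesis by (simp add: mem_invariants_signs cmod_sq_hol_eval_mem_sos norm_mult)
qed

lemma psd_even_moments:
  assumes "psd_inv signs sign_act d A"
  shows "psd d (even_moments A)"
  using assms cmod_sq_parity_part_mem_invariants
  by (auto simp: psd_def psd_inv_def quad_form_even_moments intro!: nonneg_Reals_add_I)

lemma rho_inv_eq_rho:
  assumes f: "f \<in> invariants signs sign_act real_polys"
    and g: "\<And>i. i \<in> {0..m} \<Longrightarrow> g_ext g i \<in> invariants signs sign_act real_polys"
  shows "rho_inv signs sign_act f m g k d = rho f m g k d"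
proof (rule antisym)
  \<comment> \<open>\<open>psd_inv\<close> tests fewer vectors than \<open>psd\<close>, so the
    infimum is taken over a larger feasible set.\<close>
  show "rho_inv signs sign_act f m g k d \<le> rho f m g k d"
    unfolding rho_def rho_inv_def
    by (rule Inf_superset_mono) (auto simp: psd_def psd_inv_def)
  show "rho f m g k d \<le> rho_inv signs sign_act f m g k d"
    unfolding rho_def rho_inv_def
  proof (rule Inf_superset_mono, safe)
    fix y :: "'a multi \<Rightarrow> 'a multi \<Rightarrow> complex"
    assume y: "y \<in> herm d" "y (\<lambda>_. 0) (\<lambda>_. 0) = 1"
      and psd: "\<forall>i\<in>{0..m}. psd_inv signs sign_act (d - k_ext k i) (loc_mat (g_ext g i) y)"
    have "\<forall>i\<in>{0..m}. psd (d - k_ext k i) (loc_mat (g_ext g i) (even_moments y))"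
      using psd by (simp add: loc_mat_even_moments g psd_even_moments)
    \<comment> \<open>The normalization survives because the index pair at the origin has total
      degree 0, which is even.\<close>
    moreover have "even_moments y (\<lambda>_. 0) (\<lambda>_. 0) = 1"
      using y(2) by (simp add: even_moments_def)
    ultimately show "\<exists>y'. ereal (Re (riesz y f)) = ereal (Re (riesz y' f)) \<and>
        y' \<in> herm d \<and> y' (\<lambda>_. 0) (\<lambda>_. 0) = 1 \<and>
        (\<forall>i\<in>{0..m}. psd (d - k_ext k i) (loc_mat (g_ext g i) y'))"
      using even_moments_herm[OF y(1)]
      by (intro exI[of _ "even_moments y"]) (simp add: riesz_even_moments f)
  qed
qed

section \<open>The dual side: averaging sums of squares\<close>

lemma hol_polys_scale:
  assumes "p \<in> hol_polys d"
  shows "(\<lambda>z. a * p z) \<in> hol_polys d"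
proof -
  obtain c where "p = hol_eval d c" using assms by (auto simp: hol_polys_def)
  then have "(\<lambda>z. a * p z) = hol_eval d (\<lambda>\<alpha>. a * c \<alpha>)"
    by (simp add: fun_eq_iff hol_eval_def sum_distrib_left mult_ac)
  then show ?thesis by (simp add: hol_polys_def)
qed

lemma hol_polys_reflect:
  assumes "p \<in> hol_polys d"
  shows "(\<lambda>z. p (- z)) \<in> hol_polys d"
proof -
  obtain c where "p = hol_eval d c" using assms by (auto simp: hol_polys_def)
  then have "(\<lambda>z. p (- z)) = hol_eval d (\<lambda>\<alpha>. (-1) ^ mdeg \<alpha> * c \<alpha>)"
    by (simp add: hol_eval_uminus)
  then show ?thesis by (simp add: hol_polys_def)
qed

lemma sos_reflect:
  assumes "\<phi> \<in> sos d"
  shows "(\<lambda>z. \<phi> (- z)) \<in> sos d"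
proof -
  obtain r :: nat and p where "r \<ge> 1" "\<forall>j\<in>{1..r}. p j \<in> hol_polys d"
    "\<And>z. \<phi> z = (\<Sum>j=1..r. (cmod (p j z))\<^sup>2)"
    using assms by (auto simp: sos_def)
  then show ?thesis unfolding sos_def
    by (auto intro!: exI[of _ r] exI[of _ "\<lambda>j z. p j (- z)"] hol_polys_reflect)
qed

lemma sos_scale:
  assumes "\<phi> \<in> sos d" "a \<ge> 0"
  shows "(\<lambda>z. a * \<phi> z) \<in> sos d"
proof -
  obtain r :: nat and p where "r \<ge> 1" "\<forall>j\<in>{1..r}. p j \<in> hol_polys d"
    "\<And>z. \<phi> z = (\<Sum>j=1..r. (cmod (p j z))\<^sup>2)"
    using assms by (auto simp: sos_def)
  with assms(2) show ?thesis unfolding sos_def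
    \<comment> \<open>The factor \<open>a\<close> enters each squared modulus as its square
      root.\<close>
    by (auto intro!: exI[of _ r] exI[of _ "\<lambda>j z. complex_of_real (sqrt a) * p j z"] hol_polys_scale
        simp: norm_mult power_mult_distrib sum_distrib_left)
qed

lemma sos_add:
  assumes "\<phi> \<in> sos d" "\<psi> \<in> sos d"
  shows "(\<lambda>z. \<phi> z + \<psi> z) \<in> sos d"
proof -
  obtain r :: nat and p where p: "r \<ge> 1" "\<forall>j\<in>{1..r}. p j \<in> hol_polys d"
    "\<And>z. \<phi> z = (\<Sum>j=1..r. (cmod (p j z))\<^sup>2)"
    using assms(1) by (auto simp: sos_def)
  obtain s :: nat and q where q: "s \<ge> 1" "\<forall>j\<in>{1..s}. q j \<in> hol_polys d"
    "\<And>z. \<psi> z = (\<Sum>j=1..s. (cmod (q j z))\<^sup>2)"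
    using assms(2) by (auto simp: sos_def)
  \<comment> \<open>Concatenates the two lists of polynomials; indices start at 1, so
    \<open>q\<close> is read at \<open>j - r\<close> from \<open>j = r + 1\<close> on.\<close>
  define h where "h j = (if j \<le> r then p j else q (j - r))" for j
  have "\<phi> z + \<psi> z = (\<Sum>j=1..r+s. (cmod (h j z))\<^sup>2)" for z
  proof -
    have "(\<Sum>j=1..r+s. (cmod (h j z))\<^sup>2)
        = (\<Sum>j=1..r. (cmod (h j z))\<^sup>2) + (\<Sum>j=r+1..r+s. (cmod (h j z))\<^sup>2)"
      by (rule sum.ub_add_nat) simp
    also have "(\<Sum>j=r+1..r+s. (cmod (h j z))\<^sup>2) = (\<Sum>j=1..s. (cmod (h (j + r) z))\<^sup>2)"
      using sum.shift_bounds_cl_nat_ivl[of "\<lambda>j. (cmod (h j z))\<^sup>2" 1 r s] by (simp add: add.commute)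
    finally show ?thesis by (simp add: p(3) q(3) h_def)
  qed
  moreover have "\<forall>j\<in>{1..r+s}. h j \<in> hol_polys d"
  proof
    fix j assume "j \<in> {1..r+s}"
    then have "j - r \<in> {1..s}" if "\<not> j \<le> r" using that by auto
    then show "h j \<in> hol_polys d" using p(2) q(2) \<open>j \<in> {1..r+s}\<close> by (auto simp: h_def)
  qed
  ultimately show ?thesis unfolding sos_def using p(1)
    by (auto intro!: exI[of _ "r + s"] exI[of _ h])
qed

lemma sos_symmetrize:
  assumes "\<phi> \<in> sos d"
  shows "(\<lambda>z. (1/2) * (\<phi> z + \<phi> (- z))) \<in> invariants signs sign_act (sos d)"
  using assms sos_reflect[OF assms]
  by (auto simp only: mem_invariants_signs minus_minus add.commute intro!: sos_scale sos_add)

lemma rho_inv_dual_eq_rho_dual: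
  assumes f: "f \<in> invariants signs sign_act real_polys"
    and g: "\<And>i. i \<in> {0..m} \<Longrightarrow> g_ext g i \<in> invariants signs sign_act real_polys"
  shows "rho_inv_dual signs sign_act f m g k d = rho_dual f m g k d"
proof (rule antisym)
  show "rho_inv_dual signs sign_act f m g k d \<le> rho_dual f m g k d"
    unfolding rho_dual_def rho_inv_dual_def
    by (rule Sup_subset_mono) (auto simp: invariants_def)
  show "rho_dual f m g k d \<le> rho_inv_dual signs sign_act f m g k d"
    unfolding rho_dual_def rho_inv_dual_def
  proof (rule Sup_subset_mono, safe)
    fix l and \<sigma> :: "nat \<Rightarrow> complex ^ 'a \<Rightarrow> real"
    assume \<sigma>: "\<forall>i\<in>{0..m}. \<sigma> i \<in> sos (d - k_ext k i)"
      and eq: "\<forall>z. f z - l = (\<Sum>i=0..m. \<sigma> i z * g_ext g i z)"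
    \<comment> \<open>The mean of each multiplier and its reflection is invariant and is still a sum
      of squares of the same degree bound.\<close>
    let ?\<tau> = "\<lambda>i z. (1/2) * (\<sigma> i z + \<sigma> i (- z))"
    have "f z - l = (\<Sum>i=0..m. ?\<tau> i z * g_ext g i z)" for z
    proof -
      \<comment> \<open>Evenness of \<open>f\<close> permits averaging the certificate at
        \<open>z\<close> and at \<open>-z\<close> with \<open>l\<close> unchanged; evenness of the
        constraints then lets each be factored out.\<close>
      have "f z - l = (1/2) * ((f z - l) + (f (- z) - l))"
        using f by (simp add: mem_invariants_signs)
      also have "\<dots> = (\<Sum>i=0..m. (1/2) * (\<sigma> i z * g_ext g i z + \<sigma> i (- z) * g_ext g i (- z)))"
        unfolding eq[rule_format] sum.distrib[symmetric] sum_distrib_left ..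
      also have "\<dots> = (\<Sum>i=0..m. ?\<tau> i z * g_ext g i z)"
        by (rule sum.cong) (use g in \<open>auto simp: mem_invariants_signs algebra_simps\<close>)
      finally show ?thesis .
    qed
    moreover have "\<forall>i\<in>{0..m}. ?\<tau> i \<in> invariants signs sign_act (sos (d - k_ext k i))"
      using \<sigma> sos_symmetrize by blast
    ultimately show "\<exists>l'. ereal l = ereal l' \<and>
        (\<exists>\<tau>. (\<forall>i\<in>{0..m}. \<tau> i \<in> invariants signs sign_act (sos (d - k_ext k i))) \<and>
          (\<forall>z. f z - l' = (\<Sum>i=0..m. \<tau> i z * g_ext g i z)))"
      by (intro exI[of _ l] conjI refl exI[of _ ?\<tau>]) blast+
  qed
qed

theorem proposition3p15:
  fixes f :: "complex ^ 'n::finite \<Rightarrow> real"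
    and g :: "nat \<Rightarrow> complex ^ 'n \<Rightarrow> real"
    and m kf :: nat
    and k :: "nat \<Rightarrow> nat"
  assumes "m \<ge> 1"
    and "f \<in> invariants signs sign_act real_polys"
    and "\<forall>i\<in>{1..m}. g i \<in> invariants signs sign_act real_polys"
    and "has_degree f kf"
    and "\<forall>i\<in>{1..m}. has_degree (g i) (k i)"
    and "compact {z. \<forall>i\<in>{1..m}. g i z \<ge> 0}"
  shows "\<forall>d \<ge> d_min kf m k.
           rho_inv signs sign_act f m g k d = rho f m g k d \<and>
           rho_inv_dual signs sign_act f m g k d = rho_dual f m g k d"
proof -
  have "g_ext g i \<in> invariants signs sign_act real_polys" if "i \<in> {0..m}" for i
    using assms(3) that by (auto simp: g_ext_def one_mem_invariants)
  with assms(2) show ?thesis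
    by (blast intro: rho_inv_eq_rho rho_inv_dual_eq_rho_dual)
qed

end
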